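(* Let $d,n\ge1$ be integers. Equip $\mathbb{R}^n\times\mathcal{Z}_d$ with the Euclidean product metric. Then the map $\mathcal{L}:\mathcal{A}_d(\mathbb{R}^n)\to\mathbb{R}^n\times\mathcal{Z}_d$ given by $$\mathcal{L}([\![\bar x]\!])=\big(\sqrt d\,b([\![\bar x]\!]),\,[\![\bar x-b([\![\bar x]\!])]\!]\big)$$ is an isometric homeomorphism. Moreover: (i) $\mathcal{Z}_d$ does not contain any geodesic line (i.e. there is no isometric embedding $\mathbb{R}\to\mathcal{Z}_d$); (ii) there exists an open map $F:\mathcal{A}_{d-1}(\mathbb{R}^n)\to\mathcal{Z}_d$ such that $\#F^{-1}(p)\le d$ for all $p\in\mathcal{Z}_d$, and $\ell(F\circ\gamma)=\ell(\gamma)$ for all curves $\gamma$ in $\mathcal{A}_{d-1}(\mathbb{R}^n)$.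
   Context: $\mathcal{A}_d(\mathbb{R}^n)=(\mathbb{R}^n)^d/S_d$ is the space of unordered $d$-tuples $[\![\bar x]\!]=[\![x_1,\dots,x_d]\!]$ with metric $d_{\mathcal A}([\![\bar x]\!],[\![\bar y]\!])=\min_{\sigma\in S_d}(\sum_j|x_j-y_{\sigma(j)}|^2)^{1/2}$; by convention $\mathcal{A}_0(\mathbb{R}^n)=\{0\}$. The barycenter map is $b:\mathcal{A}_d(\mathbb{R}^n)\to\mathbb{R}^n$, $b([\![x_1,\dots,x_d]\!])=(x_1+\cdots+x_d)/d$, and $\mathcal{Z}_d=\{[\![\bar x]\!]\in\mathcal{A}_d(\mathbb{R}^n):b([\![\bar x]\!])=0\}$ with the metric $d_{\mathcal A}$. Also $[\![\bar x-b([\![\bar x]\!])]\!]=[\![x_1-b([\![\bar x]\!]),\dots,x_d-b([\![\bar x]\!])]\!]\in\mathcal{Z}_d$. $\ell$ denotes the length of a curve. *)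

theory Defs
  imports "HOL-Analysis.Analysis" "HOL-Combinatorics.Combinatorics"
begin

definition tuple_dist :: "'a::metric_space list \<Rightarrow> 'a list \<Rightarrow> real" where
  "tuple_dist xs ys =
     (MIN \<sigma> \<in> {\<sigma>. \<sigma> permutes {..<length xs}}.
        sqrt (\<Sum>j<length xs. (dist (xs ! j) (ys ! \<sigma> j))\<^sup>2))"

text \<open>
  An unordered tuple \<open>\<lbrakk>x\<^sub>1, \<dots>, x\<^sub>d\<rbrakk>\<close> is the multiset \<open>mset [x\<^sub>1, \<dots>, x\<^sub>d]\<close>, i.e. the class of
  an ordered tuple up to permutation. The distance below is computed on representatives, and
  lemma \<open>unordered_dist_mset\<close> shows that their choice is irrelevant. Multisets of different sizes are
  never compared; the value 0 for them only serves the locale \<open>Metric_space\<close>, whose symmetry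
  and nonnegativity axioms are not relativised to the carrier.
\<close>

definition unordered_dist :: "'a::metric_space multiset \<Rightarrow> 'a multiset \<Rightarrow> real" where
  "unordered_dist X Y =
     (if size X = size Y
      then tuple_dist (SOME xs. mset xs = X) (SOME ys. mset ys = Y) else 0)"

definition unordered_tuples :: "nat \<Rightarrow> 'a::metric_space multiset metric" where
  "unordered_tuples d = metric ({X. size X = d}, unordered_dist)"

definition barycenter :: "'a::real_vector multiset \<Rightarrow> 'a" where
  "barycenter X = sum_mset X /\<^sub>R real (size X)"

definition centered_tuples :: "nat \<Rightarrow> 'a::real_normed_vector multiset metric" where
  "centered_tuples d = submetric (unordered_tuples d) {X. barycenter X = 0}"

definition split_barycenter :: "nat \<Rightarrow> 'a::real_vector multiset \<Rightarrow> 'a \<times> 'a multiset" where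
  "split_barycenter d X =
     (sqrt (real d) *\<^sub>R barycenter X, image_mset (\<lambda>x. x - barycenter X) X)"

definition isometric_embedding :: "'a metric \<Rightarrow> 'b metric \<Rightarrow> ('a \<Rightarrow> 'b) \<Rightarrow> bool" where
  "isometric_embedding m1 m2 f \<longleftrightarrow>
     f \<in> mspace m1 \<rightarrow> mspace m2 \<and>
     (\<forall>x\<in>mspace m1. \<forall>y\<in>mspace m1. mdist m2 (f x) (f y) = mdist m1 x y)"

definition curve_length :: "'a metric \<Rightarrow> real set \<Rightarrow> (real \<Rightarrow> 'a) \<Rightarrow> ennreal" where
  "curve_length m I \<gamma> =
     (SUP (k, t) \<in> {(k::nat, t). t \<in> {..k} \<rightarrow> I \<and> mono_on {..k} t}.
        \<Sum>i<k. ennreal (mdist m (\<gamma> (t i)) (\<gamma> (t (Suc i)))))"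


lemma tuple_dist_attained:
  obtains \<sigma> where "\<sigma> permutes {..<length xs}"
    and "tuple_dist xs ys = L2_set (\<lambda>j. dist (xs ! j) (ys ! \<sigma> j)) {..<length xs}"
proof -
  let ?S = "{\<sigma>. \<sigma> permutes {..<length xs}}"
  let ?f = "\<lambda>\<sigma>. sqrt (\<Sum>j<length xs. (dist (xs ! j) (ys ! \<sigma> j))\<^sup>2)"
  have "finite ?S" by (simp add: finite_permutations)
  moreover have "?S \<noteq> {}" using permutes_id by blast
  ultimately have "Min (?f ` ?S) \<in> ?f ` ?S" by (intro Min_in) auto
  then show ?thesis using that unfolding tuple_dist_def L2_set_def by blast
qed

lemma tuple_dist_le:
  assumes "\<sigma> permutes {..<length xs}"
  shows "tuple_dist xs ys \<le> L2_set (\<lambda>j. dist (xs ! j) (ys ! \<sigma> j)) {..<length xs}"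
  unfolding tuple_dist_def L2_set_def
  by (rule Min_le) (use assms in \<open>auto simp: finite_permutations\<close>)

lemma tuple_dist_le2:
  assumes p: "p permutes {..<length xs}" and q: "q permutes {..<length xs}"
  shows "tuple_dist xs ys \<le> L2_set (\<lambda>j. dist (xs ! p j) (ys ! q j)) {..<length xs}"
proof -
  let ?r = "q \<circ> inv p"
  have r: "?r permutes {..<length xs}"
    by (intro permutes_compose permutes_inv p q)
  have "L2_set (\<lambda>j. dist (xs ! j) (ys ! ?r j)) {..<length xs} =
        L2_set (\<lambda>j. dist (xs ! p j) (ys ! q j)) {..<length xs}"
    unfolding L2_set_def
    by (subst sum.permute[OF p]) (simp add: o_def permutes_inverses[OF p])
  with tuple_dist_le[OF r, of ys] show ?thesis by simp
qed

lemma tuple_dist_mono_mset: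
  assumes "mset xs = mset xs'" "mset ys = mset ys'" and len: "length xs = length ys"
  shows "tuple_dist xs ys \<le> tuple_dist xs' ys'"
proof -
  have len': "length xs' = length xs" "length ys' = length ys"
    using assms by (metis size_mset)+
  obtain p where p: "p permutes {..<length xs}" "permute_list p xs = xs'"
    using mset_eq_permutation[of xs' xs] assms by auto
  obtain q where q: "q permutes {..<length ys}" "permute_list q ys = ys'"
    using mset_eq_permutation[of ys' ys] assms by auto
  obtain s where s: "s permutes {..<length xs'}"
    "tuple_dist xs' ys' = L2_set (\<lambda>j. dist (xs' ! j) (ys' ! s j)) {..<length xs'}"
    by (rule tuple_dist_attained)
  have "tuple_dist xs ys \<le> L2_set (\<lambda>j. dist (xs ! p j) (ys ! (q \<circ> s) j)) {..<length xs}"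
    by (intro tuple_dist_le2 permutes_compose) (use p q s len len' in auto)
  also have "\<dots> = L2_set (\<lambda>j. dist (xs' ! j) (ys' ! s j)) {..<length xs'}"
  proof (rule L2_set_cong)
    fix j assume "j \<in> {..<length xs'}"
    moreover from this s(1) have "s j < length xs'" by (metis lessThan_iff permutes_in_image)
    ultimately show "dist (xs ! p j) (ys ! (q \<circ> s) j) = dist (xs' ! j) (ys' ! s j)"
      using p q len len' by (auto simp: permute_list_nth)
  qed (use len' in auto)
  finally show ?thesis using s by simp
qed

lemma unordered_dist_mset:
  assumes "length xs = length ys"
  shows "unordered_dist (mset xs) (mset ys) = tuple_dist xs ys"
proof -
  define xs' where "xs' = (SOME zs. mset zs = mset xs)"
  define ys' where "ys' = (SOME zs. mset zs = mset ys)"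
  have m: "mset xs' = mset xs" "mset ys' = mset ys"
    unfolding xs'_def ys'_def by (rule someI[where x=xs] someI[where x=ys], rule refl)+
  then have "length xs' = length ys'" using assms by (metis size_mset)
  with m assms have "tuple_dist xs' ys' = tuple_dist xs ys"
    by (intro antisym tuple_dist_mono_mset) auto
  then show ?thesis using assms by (simp add: unordered_dist_def xs'_def ys'_def)
qed

lemma tuple_dist_nonneg: "0 \<le> tuple_dist xs ys"
  using tuple_dist_attained[of xs ys] by (metis L2_set_nonneg)

lemma tuple_dist_commute_le:
  assumes "length xs = length ys"
  shows "tuple_dist ys xs \<le> tuple_dist xs ys"
proof -
  obtain s where s: "s permutes {..<length xs}"
    "tuple_dist xs ys = L2_set (\<lambda>j. dist (xs ! j) (ys ! s j)) {..<length xs}"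
    by (rule tuple_dist_attained)
  have "tuple_dist ys xs \<le> L2_set (\<lambda>j. dist (ys ! s j) (xs ! id j)) {..<length ys}"
    by (rule tuple_dist_le2) (use s assms in \<open>auto simp: permutes_id[unfolded id_def]\<close>)
  then show ?thesis using s assms by (simp add: dist_commute)
qed

lemma tuple_dist_triangle:
  assumes "length xs = length ys" "length ys = length zs"
  shows "tuple_dist xs zs \<le> tuple_dist xs ys + tuple_dist ys zs"
proof -
  let ?I = "{..<length xs}"
  obtain s where s: "s permutes ?I"
    "tuple_dist xs ys = L2_set (\<lambda>j. dist (xs ! j) (ys ! s j)) ?I"
    by (rule tuple_dist_attained)
  obtain t where t: "t permutes ?I"
    "tuple_dist ys zs = L2_set (\<lambda>j. dist (ys ! j) (zs ! t j)) ?I"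
    using tuple_dist_attained[of ys zs] assms by metis
  have "tuple_dist xs zs \<le> L2_set (\<lambda>j. dist (xs ! j) (zs ! (t \<circ> s) j)) ?I"
    by (intro tuple_dist_le permutes_compose s t)
  also have "\<dots> \<le> L2_set (\<lambda>j. dist (xs ! j) (ys ! s j) + dist (ys ! s j) (zs ! t (s j))) ?I"
    by (intro L2_set_mono) (auto simp: dist_triangle)
  also have "\<dots> \<le> L2_set (\<lambda>j. dist (xs ! j) (ys ! s j)) ?I
                   + L2_set (\<lambda>j. dist (ys ! s j) (zs ! t (s j))) ?I"
    by (rule L2_set_triangle_ineq)
  also have "L2_set (\<lambda>j. dist (ys ! s j) (zs ! t (s j))) ?I =
             L2_set (\<lambda>j. dist (ys ! j) (zs ! t j)) ?I"
    unfolding L2_set_def by (subst (2) sum.permute[OF s(1)]) (simp add: o_def)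
  finally show ?thesis using s t by simp
qed

lemma tuple_dist_eq_0_iff:
  assumes len: "length xs = length ys"
  shows "tuple_dist xs ys = 0 \<longleftrightarrow> mset xs = mset ys"
proof
  assume 0: "tuple_dist xs ys = 0"
  obtain s where s: "s permutes {..<length xs}"
    "tuple_dist xs ys = L2_set (\<lambda>j. dist (xs ! j) (ys ! s j)) {..<length xs}"
    by (rule tuple_dist_attained)
  with 0 have "\<forall>j<length xs. xs ! j = ys ! s j"
    by (simp add: L2_set_eq_0_iff)
  then have "xs = permute_list s ys"
    using s len by (intro nth_equalityI) (auto simp: permute_list_nth)
  then show "mset xs = mset ys"
    using s len by simp
next
  assume "mset xs = mset ys"
  then have "tuple_dist xs ys \<le> tuple_dist xs xs"
    by (intro tuple_dist_mono_mset) (auto simp: len)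
  also have "\<dots> \<le> 0"
    using tuple_dist_le[OF permutes_id, of xs xs] by (simp add: L2_set_def)
  finally show "tuple_dist xs ys = 0"
    using tuple_dist_nonneg[of xs ys] by simp
qed

lemma Metric_space_unordered_dist:
  "Metric_space {X. size X = d} (unordered_dist :: 'a::metric_space multiset \<Rightarrow> _)"
proof
  show "0 \<le> unordered_dist X Y" for X Y :: "'a multiset"
    by (simp add: unordered_dist_def tuple_dist_nonneg)
  show "unordered_dist X Y = unordered_dist Y X" for X Y :: "'a multiset"
  proof (cases "size X = size Y")
    case True
    obtain xs ys where "mset xs = X" "mset ys = Y" by (metis ex_mset)
    with True show ?thesis
      using unordered_dist_mset[of xs ys] unordered_dist_mset[of ys xs]
        tuple_dist_commute_le[of xs ys] tuple_dist_commute_le[of ys xs] by auto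
  qed (simp add: unordered_dist_def)
  fix X Y Z :: "'a multiset"
  assume XY: "X \<in> {X. size X = d}" "Y \<in> {X. size X = d}"
  obtain xs ys zs where m: "mset xs = X" "mset ys = Y" "mset zs = Z" by (metis ex_mset)
  with XY have len: "length xs = length ys" by auto
  show "unordered_dist X Y = 0 \<longleftrightarrow> X = Y"
    using unordered_dist_mset[OF len] tuple_dist_eq_0_iff[OF len] m by simp
  assume "Z \<in> {X. size X = d}"
  with m XY have "length ys = length zs" by auto
  with len m show "unordered_dist X Z \<le> unordered_dist X Y + unordered_dist Y Z"
    using tuple_dist_triangle[of xs ys zs] unordered_dist_mset[of xs zs]
      unordered_dist_mset[of xs ys] unordered_dist_mset[of ys zs] by simp
qed

lemma mspace_unordered_tuples [simp]: "mspace (unordered_tuples d) = {X. size X = d}"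
  by (simp add: unordered_tuples_def Metric_space.mspace_metric Metric_space_unordered_dist)

lemma mdist_unordered_tuples [simp]: "mdist (unordered_tuples d) = unordered_dist"
  by (simp add: unordered_tuples_def Metric_space.mdist_metric Metric_space_unordered_dist)

lemma mspace_centered_tuples [simp]:
  "mspace (centered_tuples d) = {X. size X = d \<and> barycenter X = 0}"
  by (auto simp: centered_tuples_def)

lemma mdist_centered_tuples [simp]: "mdist (centered_tuples d) = unordered_dist"
  by (simp add: centered_tuples_def)

end

theory Submission
  imports Defs
begin

text \<open>
  An unordered tuple is an orbit of \<open>S\<^sub>d\<close> acting on \<open>V\<^sup>d\<close> by permuting coordinates, an action by
  linear isometries, and the distance of two orbits is the least distance between representatives
  (\<open>unordered_dist_le_list_dist\<close>, \<open>unordered_dist_attained\<close>). Each part of the theorem is an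
  elementary fact about \<open>V\<^sup>d\<close> that passes to the orbits.

  \<^item> Subtracting the barycenter from every entry is the orthogonal projection onto the tuples of sum
    zero, whose complement is the diagonal. Pythagoras (\<open>list_dist_split\<close>) holds for all
    representatives simultaneously, with a diagonal term that does not depend on their order, so it
    survives the minimisation.

  \<^item> In \<open>Z\<^sub>d\<close> one has \<open>d(X,Y)\<^sup>2 \<le> \<bar>X\<bar>\<^sup>2 + \<bar>Y\<bar>\<^sup>2\<close>, where \<open>\<bar>X\<bar>\<close> is the distance to the origin
    (\<open>unordered_dist_sq_le_centered\<close>): averaged over the cyclic rotations of \<open>Y\<close> the inner product
    with \<open>X\<close> vanishes, so some rotation makes an angle of at most \<open>90\<close> degrees with \<open>X\<close>. On a geodesic
    line the points at parameters \<open>T\<close> and \<open>-T\<close> have norm at most \<open>T + C\<close> and distance \<open>2T\<close>, which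
    contradicts the inequality as soon as \<open>T\<close> is large compared with \<open>C\<close>.

  \<^item> The map \<open>F\<close> comes from a linear isometry \<open>\<phi>\<close> of the ordered \<open>(d - 1)\<close>-tuples onto the
    ordered \<open>d\<close>-tuples of sum zero, chosen to commute with permutations of the first \<open>d - 1\<close> entries. Hence
    \<open>F\<close> maps every ball onto the ball of the same radius (\<open>zero_sum_extension_lift\<close>), which makes
    it open, and a preimage of \<open>p\<close> is determined by the entry of \<open>p\<close> that \<open>\<phi>\<close> appended, which
    leaves at most \<open>d\<close> choices (\<open>zero_sum_extension_fibre\<close>).

  \<^item> Although \<open>F\<close> is not locally isometric at tuples with many symmetries, it preserves the distances
    \<^emph>\<open>to\<close> each point from nearby points (\<open>unordered_dist_zero_sum_extension_near\<close>): near an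
    orbit point \<open>y\<close> the only competing permutations are those that fix \<open>y\<close>, and they do not change the
    distance to \<open>y\<close>. Length is already controlled by distances of this kind, by bisection
    of the parameter interval (\<open>curve_length_le_if_locally_le\<close>), so no lifting of curves to ordered
    tuples is involved.
\<close>

section \<open>Distances through ordered representatives\<close>

definition list_dist :: "'a::metric_space list \<Rightarrow> 'a list \<Rightarrow> real" where
  "list_dist xs ys = L2_set (\<lambda>j. dist (xs ! j) (ys ! j)) {..<length xs}"

lemma list_dist_nonneg: "0 \<le> list_dist xs ys"
  by (simp add: list_dist_def)

lemma list_dist_commute: "length xs = length ys \<Longrightarrow> list_dist xs ys = list_dist ys xs"
  by (simp add: list_dist_def dist_commute)

lemma list_dist_triangle:
  assumes "length xs = length ys" "length ys = length zs"
  shows "list_dist xs zs \<le> list_dist xs ys + list_dist ys zs"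
proof -
  have "list_dist xs zs \<le>
      L2_set (\<lambda>j. dist (xs ! j) (ys ! j) + dist (ys ! j) (zs ! j)) {..<length xs}"
    unfolding list_dist_def by (intro L2_set_mono) (auto simp: dist_triangle)
  also have "\<dots> \<le> list_dist xs ys + list_dist ys zs"
    using assms by (simp add: list_dist_def L2_set_triangle_ineq)
  finally show ?thesis .
qed

lemma list_dist_pos:
  assumes "length xs = length ys" "xs \<noteq> ys"
  shows "0 < list_dist xs ys"
proof -
  have "list_dist xs ys \<noteq> 0"
    using assms by (auto simp: list_dist_def L2_set_eq_0_iff intro: nth_equalityI)
  then show ?thesis using list_dist_nonneg[of xs ys] by simp
qed

lemma list_dist_sq:
  fixes xs ys :: "'a::real_normed_vector list"
  shows "(list_dist xs ys)\<^sup>2 = (\<Sum>j<length xs. (norm (xs ! j - ys ! j))\<^sup>2)"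
  by (simp add: list_dist_def L2_set_def dist_norm sum_nonneg)

lemma sum_nth_eq_sum_list: "(\<Sum>j<length xs. f (xs ! j)) = sum_list (map f xs)"
  by (simp add: sum_list_sum_nth lessThan_atLeast0)

lemma unordered_dist_le_list_dist:
  assumes "length xs = length ys"
  shows "unordered_dist (mset xs) (mset ys) \<le> list_dist xs ys"
  using tuple_dist_le[OF permutes_id, of xs ys] assms
  by (simp add: unordered_dist_mset list_dist_def)

lemma unordered_dist_attained:
  assumes xs: "mset xs = X" and size: "size X = size Y"
  obtains ys where "mset ys = Y" "length ys = length xs" "list_dist xs ys = unordered_dist X Y"
proof -
  obtain zs where zs: "mset zs = Y" by (metis ex_mset)
  with assms have len: "length zs = length xs" by (metis size_mset)
  obtain s where s: "s permutes {..<length xs}"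
    "tuple_dist xs zs = L2_set (\<lambda>j. dist (xs ! j) (zs ! s j)) {..<length xs}"
    by (rule tuple_dist_attained)
  show ?thesis
  proof
    show "mset (permute_list s zs) = Y" using s zs len by simp
    show "length (permute_list s zs) = length xs" using len by simp
    have "list_dist xs (permute_list s zs) = tuple_dist xs zs"
      unfolding list_dist_def s(2)
      by (intro L2_set_cong) (use s len in \<open>auto simp: permute_list_nth\<close>)
    then show "list_dist xs (permute_list s zs) = unordered_dist X Y"
      using unordered_dist_mset[of xs zs] xs zs len by simp
  qed
qed

text \<open>
  The rearrangements of \<open>xs\<close> other than \<open>xs\<close> itself form a finite set, hence keep some distance
  \<open>2 * r\<close> from it. If \<open>ys\<close> is within \<open>r\<close> of \<open>xs\<close>, then the rearrangement of \<open>xs\<close> closest to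
  \<open>ys\<close> is within \<open>r\<close> of \<open>ys\<close> as well, so within \<open>2 * r\<close> of \<open>xs\<close>, and must be \<open>xs\<close>.
\<close>
lemma unordered_dist_eq_list_dist_near:
  fixes xs :: "'a::metric_space list"
  obtains r where "r > 0"
    "\<And>ys. length ys = length xs \<Longrightarrow> list_dist xs ys < r \<Longrightarrow>
       unordered_dist (mset xs) (mset ys) = list_dist xs ys"
proof -
  define P where "P = {zs. mset zs = mset xs \<and> zs \<noteq> xs}"
  define r where "r = Min (insert 1 (list_dist xs ` P)) / 2"
  have "finite P"
    by (rule finite_subset[OF _ finite_permutations_of_multiset[of "mset xs"]])
      (auto simp: P_def permutations_of_multiset_def)
  moreover have "0 < list_dist xs zs" if "zs \<in> P" for zs
    by (rule list_dist_pos) (use that in \<open>auto simp: P_def dest: mset_eq_length\<close>)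
  ultimately have r: "r > 0" "\<And>zs. zs \<in> P \<Longrightarrow> 2 * r \<le> list_dist xs zs"
    by (auto simp: r_def)
  show ?thesis
  proof
    show "r > 0" by (rule r)
    fix ys assume len: "length ys = length xs" and near: "list_dist xs ys < r"
    obtain zs where zs: "mset zs = mset xs" "length zs = length ys"
      "list_dist ys zs = unordered_dist (mset ys) (mset xs)"
      using unordered_dist_attained[OF refl, of ys "mset xs"] len by auto
    have sym: "unordered_dist (mset ys) (mset xs) = unordered_dist (mset xs) (mset ys)"
      using Metric_space.commute[OF Metric_space_unordered_dist] by blast
    have "unordered_dist (mset xs) (mset ys) < r"
      using unordered_dist_le_list_dist[of xs ys] len near by simp
    then have "list_dist xs zs < 2 * r"
      using list_dist_triangle[of xs ys zs] zs len near sym by simp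
    with r zs have "zs = xs" unfolding P_def by force
    then show "unordered_dist (mset xs) (mset ys) = list_dist xs ys"
      using zs sym len list_dist_commute by metis
  qed
qed

section \<open>Splitting off the barycenter\<close>

lemma barycenter_mset: "barycenter (mset xs) = sum_list xs /\<^sub>R real (length xs)"
  by (simp add: barycenter_def sum_mset_sum_list)

text \<open>
  Pythagoras for the mean of the differences \<open>xs ! j - ys ! j\<close> and the deviations from it.
\<close>
lemma list_dist_split:
  fixes xs ys :: "'a::real_inner list"
  assumes len: "length xs = length ys" and ne: "xs \<noteq> []"
  defines "a \<equiv> barycenter (mset xs)" and "b \<equiv> barycenter (mset ys)"
  shows "(list_dist xs ys)\<^sup>2 = real (length xs) * (dist a b)\<^sup>2
    + (list_dist (map (\<lambda>x. x - a) xs) (map (\<lambda>y. y - b) ys))\<^sup>2"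
proof -
  define c where "c = a - b"
  have nz: "ys \<noteq> []" using len ne by auto
  let ?d = "\<lambda>j. xs ! j - ys ! j"
  have "(\<Sum>j<length xs. ?d j) = sum_list xs - sum_list ys"
    using sum_nth_eq_sum_list[of id xs] sum_nth_eq_sum_list[of id ys] len
    by (simp add: sum_subtractf)
  also have "\<dots> = real (length xs) *\<^sub>R c"
    using len nz by (simp add: c_def a_def b_def barycenter_mset scaleR_diff_right)
  finally have s: "(\<Sum>j<length xs. ?d j) = real (length xs) *\<^sub>R c" .
  have "(list_dist (map (\<lambda>x. x - a) xs) (map (\<lambda>y. y - b) ys))\<^sup>2
      = (\<Sum>j<length xs. (norm (?d j - c))\<^sup>2)"
    unfolding list_dist_sq by (auto simp: len c_def intro!: sum.cong arg_cong[where f=norm])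
  also have "\<dots> = (\<Sum>j<length xs. (norm (?d j))\<^sup>2 - 2 * (?d j \<bullet> c) + (norm c)\<^sup>2)"
    by (simp add: power2_norm_eq_inner inner_diff inner_commute algebra_simps)
  also have "\<dots> = (list_dist xs ys)\<^sup>2 - 2 * ((\<Sum>j<length xs. ?d j) \<bullet> c)
      + real (length xs) * (norm c)\<^sup>2"
    unfolding list_dist_sq inner_sum_left
    by (simp add: sum.distrib sum_subtractf sum_distrib_left)
  also have "\<dots> = (list_dist xs ys)\<^sup>2 - real (length xs) * (norm c)\<^sup>2"
    unfolding s by (simp add: power2_norm_eq_inner)
  finally show ?thesis by (simp add: c_def dist_norm)
qed

lemma barycenter_translate:
  assumes "X \<noteq> {#}"
  shows "barycenter (image_mset (\<lambda>x. x + v) X) = barycenter X + v"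
proof -
  have "sum_mset (image_mset (\<lambda>x. x + v) X) = sum_mset X + real (size X) *\<^sub>R v"
    by (induction X) (auto simp: algebra_simps)
  then show ?thesis using assms by (simp add: barycenter_def algebra_simps)
qed

lemma barycenter_centered:
  assumes "X \<noteq> {#}"
  shows "barycenter (image_mset (\<lambda>x. x - barycenter X) X) = 0"
  using barycenter_translate[OF assms, of "- barycenter X"] by simp

text \<open>
  Centering commutes with rearranging, so a best match for the tuples is also a best match for the
  centered tuples and conversely; the two inequalities use one best match each.
\<close>
lemma unordered_dist_split:
  fixes X Y :: "'a::real_inner multiset"
  assumes size: "size X = size Y" and ne: "X \<noteq> {#}"
  defines "X' \<equiv> image_mset (\<lambda>x. x - barycenter X) X"
    and "Y' \<equiv> image_mset (\<lambda>y. y - barycenter Y) Y"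
  shows "(unordered_dist X Y)\<^sup>2
    = real (size X) * (dist (barycenter X) (barycenter Y))\<^sup>2 + (unordered_dist X' Y')\<^sup>2"
proof (rule antisym)
  obtain xs where xs: "mset xs = X" by (metis ex_mset)
  with ne have xs_ne: "xs \<noteq> []" by auto
  let ?c = "\<lambda>X x. x - barycenter X"
  have len: "length xs = size X" using xs by auto
  have X': "mset (map (?c X) xs) = X'" by (simp add: X'_def xs)
  show "(unordered_dist X Y)\<^sup>2
    \<le> real (size X) * (dist (barycenter X) (barycenter Y))\<^sup>2 + (unordered_dist X' Y')\<^sup>2"
  proof -
    obtain zs where zs: "mset zs = Y'" "length zs = length xs"
      "list_dist (map (?c X) xs) zs = unordered_dist X' Y'"
      using unordered_dist_attained[OF X', of Y'] size by (auto simp: X'_def Y'_def)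
    define ys where "ys = map (\<lambda>z. z + barycenter Y) zs"
    have ys: "mset ys = Y" "map (?c Y) ys = zs" "length ys = length xs"
      by (simp_all add: ys_def zs Y'_def image_mset.compositionality o_def)
    have "unordered_dist X Y \<le> list_dist xs ys"
      using unordered_dist_le_list_dist[of xs ys] xs ys by simp
    then have "(unordered_dist X Y)\<^sup>2 \<le> (list_dist xs ys)\<^sup>2"
      using size by (intro power_mono) (simp_all add: unordered_dist_def tuple_dist_nonneg)
    then show ?thesis
      using list_dist_split[of xs ys] xs ys zs xs_ne len by simp
  qed
  show "real (size X) * (dist (barycenter X) (barycenter Y))\<^sup>2 + (unordered_dist X' Y')\<^sup>2
    \<le> (unordered_dist X Y)\<^sup>2"
  proof -
    obtain ys where ys: "mset ys = Y" "length ys = length xs"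
      "list_dist xs ys = unordered_dist X Y"
      using unordered_dist_attained[OF xs size] by blast
    have Y': "mset (map (?c Y) ys) = Y'" by (simp add: Y'_def ys)
    have "unordered_dist X' Y' \<le> list_dist (map (?c X) xs) (map (?c Y) ys)"
      using unordered_dist_le_list_dist[of "map (?c X) xs" "map (?c Y) ys"] X' Y' ys by simp
    then have "(unordered_dist X' Y')\<^sup>2 \<le> (list_dist (map (?c X) xs) (map (?c Y) ys))\<^sup>2"
      using size by (intro power_mono) (simp_all add: unordered_dist_def tuple_dist_nonneg)
    then show ?thesis
      using list_dist_split[of xs ys] xs ys xs_ne len by simp
  qed
qed

lemma mdist_split_barycenter:
  fixes X Y :: "'a::real_inner multiset"
  assumes "size X = d" "size Y = d" "d \<ge> 1"
  shows "prod_dist dist unordered_dist (split_barycenter d X) (split_barycenter d Y)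
    = unordered_dist X Y"
proof -
  have "X \<noteq> {#}" using assms by auto
  have "(dist (sqrt d *\<^sub>R barycenter X) (sqrt d *\<^sub>R barycenter Y))\<^sup>2
      = real d * (dist (barycenter X) (barycenter Y))\<^sup>2"
    by (simp add: dist_norm scaleR_diff_right[symmetric] power_mult_distrib del: scaleR_diff_right)
  then have "prod_dist dist unordered_dist (split_barycenter d X) (split_barycenter d Y)
      = sqrt ((unordered_dist X Y)\<^sup>2)"
    using unordered_dist_split[of X Y] assms \<open>X \<noteq> {#}\<close>
    by (simp add: prod_dist_def split_barycenter_def)
  then show ?thesis
    using assms by (simp add: unordered_dist_def tuple_dist_nonneg)
qed

lemma split_barycenter_image:
  assumes "d \<ge> 1"
  shows "split_barycenter d ` {X. size X = d}
    = UNIV \<times> {X :: 'a::real_normed_vector multiset. size X = d \<and> barycenter X = 0}"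
proof
  show "split_barycenter d ` {X. size X = d} \<subseteq> UNIV \<times> {X :: 'a multiset. size X = d \<and> barycenter X = 0}"
    using assms by (auto simp: split_barycenter_def intro!: barycenter_centered)
  show "UNIV \<times> {X :: 'a multiset. size X = d \<and> barycenter X = 0} \<subseteq> split_barycenter d ` {X. size X = d}"
  proof clarify
    fix v :: 'a and Z :: "'a multiset"
    assume Z: "d = size Z" "barycenter Z = 0"
    define X where "X = image_mset (\<lambda>z. z + v /\<^sub>R sqrt d) Z"
    have "Z \<noteq> {#}" using Z assms by auto
    then have "barycenter X = v /\<^sub>R sqrt d"
      unfolding X_def by (simp add: barycenter_translate Z(2))
    then have "split_barycenter d X = (v, Z)"
      using assms by (simp add: split_barycenter_def X_def image_mset.compositionality o_def)
    then show "(v, Z) \<in> split_barycenter (size Z) ` {X. size X = size Z}"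
      using Z by (intro image_eqI[of _ _ X]) (simp_all add: X_def)
  qed
qed

section \<open>Absence of lines\<close>

lemma sum_list_rotate: "sum_list (rotate k xs) = (sum_list xs :: 'a::comm_monoid_add)"
  by (metis add.commute append_take_drop_id rotate_drop_take sum_list_append)

text \<open>
  The distance is at most the one to any of the \<open>d\<close> rotations of \<open>ys\<close>, hence at most their
  quadratic mean. Over all rotations every entry of \<open>xs\<close> meets every entry of \<open>ys\<close> exactly once, so
  the mixed terms add up to the inner product of the two entry sums, which is zero.
\<close>
lemma unordered_dist_sq_le_centered:
  fixes X Y :: "'a::real_inner multiset"
  assumes "size X = d" "size Y = d" and Y: "sum_mset Y = 0"
  shows "(unordered_dist X Y)\<^sup>2
    \<le> (unordered_dist X (replicate_mset d 0))\<^sup>2 + (unordered_dist Y (replicate_mset d 0))\<^sup>2"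
proof (cases "d = 0")
  case True
  then show ?thesis using assms by (simp add: unordered_dist_def tuple_dist_def)
next
  case False
  obtain xs ys where xs: "mset xs = X" and ys: "mset ys = Y" by (metis ex_mset)
  have len: "length xs = d" "length ys = d" using assms xs ys by auto
  have origin: "(unordered_dist (mset zs) (replicate_mset d 0))\<^sup>2 = (\<Sum>j<d. (norm (zs ! j))\<^sup>2)"
    if zs: "length zs = d" for zs :: "'a list"
  proof -
    obtain os where os: "mset os = replicate_mset d (0::'a)" "length os = length zs"
      "list_dist zs os = unordered_dist (mset zs) (replicate_mset d 0)"
      using unordered_dist_attained[OF refl, of zs "replicate_mset d 0"] zs by auto
    then have "os = replicate d 0"
      by (metis in_replicate_mset replicate_eqI set_mset_mset zs)
    with os show ?thesis
      using list_dist_sq[of zs os] zs by simp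
  qed
  have "real d * (unordered_dist X Y)\<^sup>2 = (\<Sum>k<d. (unordered_dist X Y)\<^sup>2)" by simp
  also have "\<dots> \<le> (\<Sum>k<d. (list_dist xs (rotate k ys))\<^sup>2)"
  proof (intro sum_mono power_mono)
    fix k
    have "mset (rotate k ys) = Y"
      by (metis append_take_drop_id mset_append rotate_drop_take union_commute ys)
    then show "unordered_dist X Y \<le> list_dist xs (rotate k ys)"
      using unordered_dist_le_list_dist[of xs "rotate k ys"] xs len by simp
  qed (use assms in \<open>simp add: unordered_dist_def tuple_dist_nonneg\<close>)
  also have "\<dots> = (\<Sum>j<d. \<Sum>k<d. (norm (xs ! j - rotate j ys ! k))\<^sup>2)"
    unfolding list_dist_sq len
    by (subst sum.swap) (auto simp: nth_rotate len add.commute intro!: sum.cong)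
  also have "\<dots> = (\<Sum>j<d. \<Sum>k<d. (norm (xs ! j - ys ! k))\<^sup>2)"
  proof (rule sum.cong[OF refl])
    fix j
    show "(\<Sum>k<d. (norm (xs ! j - rotate j ys ! k))\<^sup>2) = (\<Sum>k<d. (norm (xs ! j - ys ! k))\<^sup>2)"
      using sum_nth_eq_sum_list[of "\<lambda>y. (norm (xs ! j - y))\<^sup>2" "rotate j ys"]
        sum_nth_eq_sum_list[of "\<lambda>y. (norm (xs ! j - y))\<^sup>2" ys] len
      by (simp add: rotate_map[symmetric] sum_list_rotate)
  qed
  also have "\<dots> = (\<Sum>j<d. \<Sum>k<d. (norm (xs ! j))\<^sup>2 + (norm (ys ! k))\<^sup>2 - 2 * (xs ! j \<bullet> ys ! k))"
    by (simp add: power2_norm_eq_inner inner_diff inner_commute algebra_simps)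
  also have "\<dots> = real d * (\<Sum>j<d. (norm (xs ! j))\<^sup>2) + real d * (\<Sum>k<d. (norm (ys ! k))\<^sup>2)
      - 2 * ((\<Sum>j<d. xs ! j) \<bullet> (\<Sum>k<d. ys ! k))"
    unfolding inner_sum_left
    by (simp add: sum.distrib sum_subtractf sum_distrib_left inner_sum_right)
  also have "(\<Sum>k<d. ys ! k) = 0"
    using sum_nth_eq_sum_list[of id ys] Y by (simp add: ys[symmetric] len sum_mset_sum_list)
  finally show ?thesis
    using False origin[OF len(1)] origin[OF len(2)]
    by (simp add: xs ys distrib_left[symmetric] del: distrib_left_numeral)
qed

lemma no_line_in_centered_tuples:
  fixes \<gamma> :: "real \<Rightarrow> 'a::real_inner multiset"
  shows "\<not> isometric_embedding euclidean_metric (centered_tuples d) \<gamma>"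
proof
  assume emb: "isometric_embedding euclidean_metric (centered_tuples d) \<gamma>"
  then have sz: "size (\<gamma> t) = d" and bc: "barycenter (\<gamma> t) = 0"
    and iso: "unordered_dist (\<gamma> s) (\<gamma> t) = dist s t" for s t
    by (auto simp: isometric_embedding_def)
  have sum0: "sum_mset (\<gamma> t) = 0" for t
    using bc[of t] by (auto simp: barycenter_def)
  let ?O = "replicate_mset d (0::'a)"
  define C where "C = unordered_dist (\<gamma> 0) ?O"
  have C: "0 \<le> C" by (simp add: C_def unordered_dist_def tuple_dist_nonneg)
  have near: "(unordered_dist (\<gamma> t) ?O)\<^sup>2 \<le> (\<bar>t\<bar> + C)\<^sup>2" for t
  proof (rule power_mono)
    show "unordered_dist (\<gamma> t) ?O \<le> \<bar>t\<bar> + C"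
      using Metric_space.triangle[OF Metric_space_unordered_dist[of d], of "\<gamma> t" "\<gamma> 0" ?O]
      by (simp add: sz iso C_def)
  qed (simp add: unordered_dist_def tuple_dist_nonneg)
  \<comment> \<open>The inequality \<open>(2T)\<^sup>2 \<le> 2 (T + C)\<^sup>2\<close> fails once \<open>T > C / (sqrt 2 - 1)\<close>; note \<open>1 / (sqrt 2 - 1) < 3\<close>.\<close>
  define T where "T = 3 * C + 1"
  have "(unordered_dist (\<gamma> T) (\<gamma> (- T)))\<^sup>2 \<le> 2 * (T + C)\<^sup>2"
    using unordered_dist_sq_le_centered[OF sz sz sum0, of T "- T"] near[of T] near[of "- T"] C
    by (simp add: T_def)
  moreover have "unordered_dist (\<gamma> T) (\<gamma> (- T)) = 2 * T"
    using C by (simp add: iso dist_real_def T_def)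
  ultimately have "(2 * T)\<^sup>2 \<le> 2 * (T + C)\<^sup>2" by simp
  then show False
    using C mult_nonneg_nonneg[OF C C] by (simp add: T_def power2_eq_square algebra_simps)
qed


section \<open>An orthogonal map onto the tuples of sum zero\<close>

text \<open>
  With \<open>d = size X + 1\<close>, this is the reflection of \<open>V\<^sup>d\<close> that exchanges the hyperplanes \<open>x\<^sub>d = 0\<close>
  and \<open>x\<^sub>1 + \<dots> + x\<^sub>d = 0\<close>, applied to \<open>(x, 0)\<close>: it sends the unit normal \<open>(0, \<dots>, 0, 1)\<close> of the
  first to the negative of the unit normal \<open>(1, \<dots>, 1) / sqrt d\<close> of the second, and so subtracts a
  multiple of the sum of the two normals. That sum is symmetric in the first \<open>d - 1\<close> coordinates,
  which is why the formula makes sense for unordered tuples.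
\<close>
definition zero_sum_extension :: "'a::real_vector multiset \<Rightarrow> 'a multiset" where
  "zero_sum_extension X =
     (let r = sqrt (real (Suc (size X))); s = sum_mset X
      in add_mset (- (s /\<^sub>R r)) (image_mset (\<lambda>x. x - s /\<^sub>R (r * (r + 1))) X))"

definition zero_sum_list :: "'a::real_vector list \<Rightarrow> 'a list" where
  "zero_sum_list xs =
     (let r = sqrt (real (Suc (length xs))); s = sum_list xs
      in map (\<lambda>x. x - s /\<^sub>R (r * (r + 1))) xs @ [- (s /\<^sub>R r)])"

lemma length_zero_sum_list [simp]: "length (zero_sum_list xs) = Suc (length xs)"
  by (simp add: zero_sum_list_def Let_def)

lemma mset_zero_sum_list: "mset (zero_sum_list xs) = zero_sum_extension (mset xs)"
  by (simp add: zero_sum_list_def zero_sum_extension_def Let_def sum_mset_sum_list)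

lemma size_zero_sum_extension [simp]: "size (zero_sum_extension X) = Suc (size X)"
  by (simp add: zero_sum_extension_def Let_def)

text \<open>
  The two scalar identities behind the reflection: the third makes the entries of an extended tuple
  add up to zero, the fourth makes the extension preserve squared norms.
\<close>
lemma reflection_coeffs:
  fixes m :: nat
  defines "r \<equiv> sqrt (real (Suc m))"
  defines "c \<equiv> inverse (r * (r + 1))"
  shows "r \<ge> 1" "real m = r\<^sup>2 - 1" "1 - real m * c - inverse r = 0"
    "real m * c\<^sup>2 + (inverse r)\<^sup>2 = 2 * c"
proof -
  show r: "r \<ge> 1" "real m = r\<^sup>2 - 1" by (simp_all add: r_def)
  have m: "real m = (r - 1) * (r + 1)" using r(2) by (simp add: power2_eq_square algebra_simps)
  have c: "c * (r + 1) = inverse r" using r(1) by (simp add: c_def)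
  have mc: "real m * c = (r - 1) * inverse r" by (simp add: m c[symmetric])
  show "1 - real m * c - inverse r = 0"
    unfolding mc using r(1) by (simp add: field_simps)
  have "real m * c\<^sup>2 + (inverse r)\<^sup>2 = real m * c * c + inverse r * (c * (r + 1))"
    unfolding c by (simp add: power2_eq_square)
  also have "\<dots> = 2 * c * (r * inverse r)" unfolding mc by (simp add: algebra_simps)
  finally show "real m * c\<^sup>2 + (inverse r)\<^sup>2 = 2 * c" using r(1) by simp
qed

lemma sum_list_translate:
  fixes v :: "'a::real_vector"
  shows "sum_list (map (\<lambda>x. x - v) xs) = sum_list xs - real (length xs) *\<^sub>R v"
  by (induction xs) (auto simp: algebra_simps)

lemma sum_zero_sum_list: "sum_list (zero_sum_list xs) = 0"
proof -
  define r where "r = sqrt (real (Suc (length xs)))"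
  define c where "c = inverse (r * (r + 1))"
  have "sum_list (zero_sum_list xs)
      = (1 - real (length xs) * c - inverse r) *\<^sub>R sum_list xs"
    unfolding zero_sum_list_def Let_def r_def[symmetric] c_def
    by (simp add: sum_list_translate algebra_simps)
  then show ?thesis
    using reflection_coeffs(3)[of "length xs"] by (simp add: r_def c_def)
qed

lemma norm_diff_scaleR_sq:
  fixes x s :: "'a::real_inner"
  shows "(norm (x - c *\<^sub>R s))\<^sup>2 = (norm x)\<^sup>2 - 2 * c * (x \<bullet> s) + c\<^sup>2 * (norm s)\<^sup>2"
  unfolding power2_norm_eq_inner
  by (simp add: inner_diff inner_commute power2_eq_square algebra_simps)

lemma list_dist_zero_sum_list:
  fixes xs ys :: "'a::real_inner list"
  assumes len: "length xs = length ys"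
  shows "list_dist (zero_sum_list xs) (zero_sum_list ys) = list_dist xs ys"
proof -
  define m where "m = length ys"
  define r where "r = sqrt (real (Suc m))"
  define c where "c = inverse (r * (r + 1))"
  define S where "S = sum_list xs - sum_list ys"
  let ?d = "\<lambda>j. xs ! j - ys ! j"
  have S: "(\<Sum>j<m. ?d j) = S"
    using sum_nth_eq_sum_list[of id xs] sum_nth_eq_sum_list[of id ys] len
    by (simp add: sum_subtractf S_def m_def)
  have nth: "zero_sum_list xs ! j - zero_sum_list ys ! j = ?d j - c *\<^sub>R S" if "j < m" for j
    using that len
    by (simp add: zero_sum_list_def Let_def nth_append m_def r_def c_def S_def algebra_simps)
  have last: "zero_sum_list xs ! m - zero_sum_list ys ! m = - (inverse r *\<^sub>R S)"
    using len
    by (simp add: zero_sum_list_def Let_def nth_append m_def r_def S_def algebra_simps)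
  have "r > 0" by (simp add: r_def)
  then have "(list_dist (zero_sum_list xs) (zero_sum_list ys))\<^sup>2
      = (\<Sum>j<m. (norm (?d j - c *\<^sub>R S))\<^sup>2) + (inverse r)\<^sup>2 * (norm S)\<^sup>2"
    using len nth last
    by (simp add: list_dist_sq m_def power_mult_distrib)
  also have "(\<Sum>j<m. (norm (?d j - c *\<^sub>R S))\<^sup>2)
      = (\<Sum>j<m. (norm (?d j))\<^sup>2 - 2 * c * (?d j \<bullet> S) + c\<^sup>2 * (norm S)\<^sup>2)"
    by (simp only: norm_diff_scaleR_sq)
  also have "\<dots> = (list_dist xs ys)\<^sup>2 - 2 * c * ((\<Sum>j<m. ?d j) \<bullet> S) + real m * c\<^sup>2 * (norm S)\<^sup>2"
    unfolding inner_sum_left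
    by (simp add: sum.distrib sum_subtractf sum_distrib_left list_dist_sq len m_def)
  also have "\<dots> + (inverse r)\<^sup>2 * (norm S)\<^sup>2
      = (list_dist xs ys)\<^sup>2 + (real m * c\<^sup>2 + (inverse r)\<^sup>2 - 2 * c) * (norm S)\<^sup>2"
    unfolding S by (simp add: power2_norm_eq_inner algebra_simps)
  also have "\<dots> = (list_dist xs ys)\<^sup>2"
    using reflection_coeffs(4)[of m] by (simp add: r_def c_def)
  finally show ?thesis by (simp add: list_dist_nonneg)
qed

lemma zero_sum_list_surj:
  fixes ys :: "'a::real_vector list"
  assumes "length ys = Suc m" "sum_list ys = 0"
  obtains xs where "length xs = m" "zero_sum_list xs = ys"
proof -
  define r where "r = sqrt (real (Suc m))"
  have r: "r \<ge> 1" "real m = r\<^sup>2 - 1" unfolding r_def by (rule reflection_coeffs)+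
  obtain zs y where ys: "ys = zs @ [y]"
    using assms(1) by (cases ys rule: rev_cases) auto
  define xs where "xs = map (\<lambda>z. z - y /\<^sub>R (r + 1)) zs"
  have len: "length zs = m" "length xs = m" using assms by (simp_all add: xs_def ys)
  have "sum_list zs = - y"
    using assms(2) by (simp add: ys eq_neg_iff_add_eq_0)
  then have "sum_list xs = - y - (real m / (r + 1)) *\<^sub>R y"
    by (simp add: xs_def sum_list_translate divide_inverse len)
  also have "real m / (r + 1) = r - 1"
    unfolding r(2) using r(1) by (simp add: field_simps power2_eq_square)
  finally have s: "sum_list xs = - (r *\<^sub>R y)" by (simp add: algebra_simps)
  have "zero_sum_list xs = map (\<lambda>x. x + y /\<^sub>R (r + 1)) xs @ [y]"
    unfolding zero_sum_list_def Let_def len s r_def[symmetric] using r(1) by simp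
  also have "\<dots> = ys"
    by (simp add: xs_def ys o_def)
  finally show ?thesis using that len by blast
qed

lemma barycenter_zero_sum_extension: "barycenter (zero_sum_extension X) = 0"
proof -
  obtain xs where "mset xs = X" by (metis ex_mset)
  then show ?thesis
    using barycenter_mset[of "zero_sum_list xs"] by (simp add: mset_zero_sum_list sum_zero_sum_list)
qed

lemma unordered_dist_zero_sum_extension_le:
  fixes X Y :: "'a::real_inner multiset"
  assumes "size X = size Y"
  shows "unordered_dist (zero_sum_extension X) (zero_sum_extension Y) \<le> unordered_dist X Y"
proof -
  obtain xs where xs: "mset xs = X" by (metis ex_mset)
  obtain ys where ys: "mset ys = Y" "length ys = length xs" "list_dist xs ys = unordered_dist X Y"
    using unordered_dist_attained[OF xs assms] by blast
  then show ?thesis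
    using unordered_dist_le_list_dist[of "zero_sum_list xs" "zero_sum_list ys"] xs
    by (simp add: mset_zero_sum_list list_dist_zero_sum_list)
qed

text \<open>
  Distances are preserved from the fixed center \<open>X\<close> only: if the appended entry coincides with
  another one, then distinct tuples arbitrarily close to \<open>X\<close> may have the same extension.
\<close>
lemma unordered_dist_zero_sum_extension_near:
  fixes X :: "'a::real_inner multiset"
  obtains r where "r > 0"
    "\<And>Y. size Y = size X \<Longrightarrow> unordered_dist X Y < r \<Longrightarrow>
       unordered_dist (zero_sum_extension X) (zero_sum_extension Y) = unordered_dist X Y"
proof -
  obtain xs where xs: "mset xs = X" by (metis ex_mset)
  obtain r where r: "r > 0" "\<And>ys. length ys = length (zero_sum_list xs) \<Longrightarrow>
      list_dist (zero_sum_list xs) ys < r \<Longrightarrow>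
      unordered_dist (mset (zero_sum_list xs)) (mset ys) = list_dist (zero_sum_list xs) ys"
    using unordered_dist_eq_list_dist_near by blast
  show ?thesis
  proof
    show "r > 0" by (rule r)
    fix Y :: "'a multiset" assume Y: "size Y = size X" "unordered_dist X Y < r"
    obtain ys where ys: "mset ys = Y" "length ys = length xs" "list_dist xs ys = unordered_dist X Y"
      using unordered_dist_attained[OF xs Y(1)[symmetric]] by blast
    then show "unordered_dist (zero_sum_extension X) (zero_sum_extension Y) = unordered_dist X Y"
      using r(2)[of "zero_sum_list ys"] xs Y
      by (simp add: mset_zero_sum_list list_dist_zero_sum_list)
  qed
qed

text \<open>
  Match \<open>Z\<close> optimally with an ordered extension of \<open>X\<close> and pull the match back through the linear
  isometry.
\<close>
lemma zero_sum_extension_lift: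
  fixes X :: "'a::real_inner multiset"
  assumes Z: "size Z = Suc (size X)" "barycenter Z = 0"
  obtains Y where "size Y = size X" "zero_sum_extension Y = Z"
    "unordered_dist X Y \<le> unordered_dist (zero_sum_extension X) Z"
proof -
  obtain xs where xs: "mset xs = X" by (metis ex_mset)
  then have len: "length xs = size X" by auto
  obtain zs where zs: "mset zs = Z" "length zs = Suc (length xs)"
    "list_dist (zero_sum_list xs) zs = unordered_dist (zero_sum_extension X) Z"
    using unordered_dist_attained[of "zero_sum_list xs" "zero_sum_extension X" Z] Z
    by (auto simp: mset_zero_sum_list xs)
  have "sum_list zs = 0"
    using barycenter_mset[of zs] Z zs by simp
  then obtain ys where ys: "length ys = length xs" "zero_sum_list ys = zs"
    using zero_sum_list_surj zs(2) by blast
  show ?thesis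
  proof
    show "size (mset ys) = size X" using ys len by simp
    show "zero_sum_extension (mset ys) = Z" using ys zs by (simp add: mset_zero_sum_list[symmetric])
    show "unordered_dist X (mset ys) \<le> unordered_dist (zero_sum_extension X) Z"
      using unordered_dist_le_list_dist[of xs ys] ys zs xs list_dist_zero_sum_list[of xs ys] by simp
  qed
qed

text \<open>
  Once the entry \<open>y\<close> of \<open>Z\<close> that was appended is known, the sum of the preimage is \<open>- r *\<^sub>R y\<close>, and
  the remaining entries of \<open>Z\<close> are translates of the preimage by a multiple of it.
\<close>
lemma zero_sum_extension_fibre:
  fixes Z :: "'a::real_vector multiset"
  assumes "size Z = Suc m"
  defines "A \<equiv> {X. size X = m \<and> zero_sum_extension X = Z}"
  shows "finite A \<and> card A \<le> Suc m"
proof -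
  define r where "r = sqrt (real (Suc m))"
  let ?g = "\<lambda>y. image_mset (\<lambda>z. z - y /\<^sub>R (r + 1)) (Z - {#y#})"
  have r: "r \<ge> 1" unfolding r_def by (rule reflection_coeffs)
  have "A \<subseteq> ?g ` set_mset Z"
  proof
    fix X assume "X \<in> A"
    then have X: "size X = m" "zero_sum_extension X = Z" by (auto simp: A_def)
    define y where "y = - (sum_mset X /\<^sub>R r)"
    have Z: "Z = add_mset y (image_mset (\<lambda>x. x + y /\<^sub>R (r + 1)) X)"
      unfolding X(2)[symmetric] zero_sum_extension_def Let_def X(1) r_def[symmetric] y_def
      by (simp add: mult.commute)
    then have "X = ?g y" by (simp add: image_mset.compositionality o_def)
    moreover have "y \<in> set_mset Z" unfolding Z by simp
    ultimately show "X \<in> ?g ` set_mset Z" by (rule image_eqI)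
  qed
  then have "finite A" "card A \<le> card (set_mset Z)"
    by (auto intro: finite_subset surj_card_le)
  moreover have "card (set_mset Z) \<le> size Z"
    by (metis card_length ex_mset set_mset_mset size_mset)
  ultimately show ?thesis using assms(1) by simp
qed

section \<open>Comparing lengths of curves\<close>

text \<open>
  Real lower bounds for the length between two parameters, realised by an actual subdivision: they
  add up when subdivisions are concatenated, without any supremum or infinite length in the way.
\<close>
definition inscribed :: "'a metric \<Rightarrow> (real \<Rightarrow> 'a) \<Rightarrow> real \<Rightarrow> real \<Rightarrow> real \<Rightarrow> bool" where
  "inscribed m h u v c \<longleftrightarrow>
     (\<exists>(k::nat) t. t \<in> {..k} \<rightarrow> {u..v} \<and> mono_on {..k} t \<and> t 0 = u \<and> t k = v
        \<and> c \<le> (\<Sum>i<k. mdist m (h (t i)) (h (t (Suc i)))))"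

lemma inscribed_weaken:
  "inscribed m h u v c \<Longrightarrow> c' \<le> c \<Longrightarrow> inscribed m h u v c'"
  unfolding inscribed_def by (blast intro: order_trans)

lemma inscribed_append:
  assumes "inscribed m h u v c" "inscribed m h v w c'"
  shows "inscribed m h u w (c + c')"
proof -
  obtain k and t :: "nat \<Rightarrow> real" where t: "t \<in> {..k} \<rightarrow> {u..v}" "mono_on {..k} t" "t 0 = u" "t k = v"
    "c \<le> (\<Sum>i<k. mdist m (h (t i)) (h (t (Suc i))))"
    using assms(1) unfolding inscribed_def by blast
  obtain l and s :: "nat \<Rightarrow> real" where s: "s \<in> {..l} \<rightarrow> {v..w}" "mono_on {..l} s" "s 0 = v" "s l = w"
    "c' \<le> (\<Sum>i<l. mdist m (h (s i)) (h (s (Suc i))))"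
    using assms(2) unfolding inscribed_def by blast
  define q where "q i = (if i \<le> k then t i else s (i - k))" for i
  have q_shift: "q (i + k) = s i" for i using s t by (simp add: q_def)
  have tk: "t i \<in> {u..v}" if "i \<le> k" for i using t that by auto
  have sl: "s i \<in> {v..w}" if "i \<le> l" for i using s that by auto
  have uvw: "u \<le> v" "v \<le> w" using tk[of 0] sl[of 0] by auto
  show ?thesis
    unfolding inscribed_def
  proof (intro exI conjI)
    show "q \<in> {..k + l} \<rightarrow> {u..w}"
    proof
      fix i assume "i \<in> {..k + l}"
      then have "i - k \<le> l" by auto
      then show "q i \<in> {u..w}"
        using tk[of i] sl[of "i - k"] uvw by (auto simp: q_def)
    qed
    show "mono_on {..k + l} q"
    proof (rule mono_onI)
      fix i j assume ij: "i \<in> {..k + l}" "j \<in> {..k + l}" "i \<le> j"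
      consider "j \<le> k" | "i \<le> k" "k < j" | "k < i" by linarith
      then show "q i \<le> q j"
      proof cases
        case 1
        then show ?thesis using ij t(2) by (auto simp: q_def mono_on_def)
      next
        case 2
        then have "j - k \<le> l" using ij by auto
        with 2 show ?thesis using tk[of i] sl[of "j - k"] by (auto simp: q_def)
      next
        case 3
        then have "i - k \<le> j - k" "j - k \<le> l" using ij by auto
        with 3 ij show ?thesis using s(2) by (simp add: q_def mono_on_def)
      qed
    qed
    show "q 0 = u" using t by (simp add: q_def)
    show "q (k + l) = w" using q_shift[of l] s by (simp add: add.commute)
    have "(\<Sum>i<k + l. mdist m (h (q i)) (h (q (Suc i))))
        = (\<Sum>i<k. mdist m (h (q i)) (h (q (Suc i))))
          + (\<Sum>i<l. mdist m (h (q (i + k))) (h (q (Suc i + k))))"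
      using sum.atLeastLessThan_concat[of 0 k "k + l" "\<lambda>i. mdist m (h (q i)) (h (q (Suc i)))"]
        sum.shift_bounds_nat_ivl[of "\<lambda>i. mdist m (h (q i)) (h (q (Suc i)))" 0 k l]
      by (simp add: lessThan_atLeast0 add.commute)
    also have "\<dots> = (\<Sum>i<k. mdist m (h (t i)) (h (t (Suc i))))
          + (\<Sum>i<l. mdist m (h (s i)) (h (s (Suc i))))"
      unfolding q_shift by (intro arg_cong2[where f="(+)"] sum.cong) (auto simp: q_def)
    finally show "c + c' \<le> (\<Sum>i<k + l. mdist m (h (q i)) (h (q (Suc i))))"
      using t s by simp
  qed
qed

text \<open>
  The hypothesis compares only distances to a common point \<open>x\<close>, but that bounds a short chord of \<open>g\<close>
  around \<open>x\<close> by the two chords of \<open>h\<close> that meet at \<open>x\<close>. Bisection cuts every chord of \<open>g\<close> into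
  short ones, and the triangle inequality puts them together again.
\<close>
lemma curve_length_le_if_locally_le:
  assumes I: "is_interval I"
    and g: "\<And>t. t \<in> I \<Longrightarrow> g t \<in> mspace m1"
    and loc: "\<And>x. x \<in> I \<Longrightarrow>
      \<exists>\<delta>>0. \<forall>t\<in>I. \<bar>t - x\<bar> < \<delta> \<longrightarrow> mdist m1 (g t) (g x) \<le> mdist m2 (h t) (h x)"
  shows "curve_length m1 I g \<le> curve_length m2 I h"
proof -
  have chord: "inscribed m2 h u v (mdist m1 (g u) (g v))" if uv: "u \<in> I" "v \<in> I" "u \<le> v" for u v
  proof -
    have sub: "x \<in> I" if "x \<in> {u..v}" for x
      using that by (auto intro: mem_is_interval_1_I[OF I uv(1,2)])
    define P where "P a b \<longleftrightarrow> a \<in> {u..v} \<and> b \<in> {u..v} \<longrightarrow>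
      inscribed m2 h a b (mdist m1 (g a) (g b))" for a b
    have "P u v"
      using \<open>u \<le> v\<close>
    proof (induction rule: Bolzano)
      case (trans a b c)
      show ?case
        unfolding P_def
      proof
        assume ac: "a \<in> {u..v} \<and> c \<in> {u..v}"
        with trans have b: "b \<in> {u..v}" by auto
        have "inscribed m2 h a c (mdist m1 (g a) (g b) + mdist m1 (g b) (g c))"
          using trans ac b by (intro inscribed_append) (auto simp: P_def)
        moreover have "mdist m1 (g a) (g c) \<le> mdist m1 (g a) (g b) + mdist m1 (g b) (g c)"
          using ac b by (intro mdist_triangle g sub) auto
        ultimately show "inscribed m2 h a c (mdist m1 (g a) (g c))"
          by (rule inscribed_weaken)
      qed
    next
      case (local x)
      then have x: "x \<in> I" using sub by auto
      from loc[OF x] obtain \<delta> where \<delta>: "\<delta> > 0"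
        "\<And>t. t \<in> I \<Longrightarrow> \<bar>t - x\<bar> < \<delta> \<Longrightarrow> mdist m1 (g t) (g x) \<le> mdist m2 (h t) (h x)"
        by blast
      have "P a b" if ab: "a \<le> x" "x \<le> b" "b - a < \<delta>" for a b
        unfolding P_def
      proof
        assume "a \<in> {u..v} \<and> b \<in> {u..v}"
        then have abI: "a \<in> I" "b \<in> I" using sub by auto
        have "mdist m1 (g a) (g b) \<le> mdist m1 (g a) (g x) + mdist m1 (g x) (g b)"
          by (intro mdist_triangle g abI x)
        also have "\<dots> \<le> mdist m2 (h a) (h x) + mdist m2 (h x) (h b)"
          using \<delta>(2)[of a] \<delta>(2)[of b] abI ab
          by (intro add_mono) (auto simp: mdist_commute[of _ _ "g b"] mdist_commute[of _ _ "h b"])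
        finally show "inscribed m2 h a b (mdist m1 (g a) (g b))"
          unfolding inscribed_def using ab
          by (intro exI[of _ 2] exI[of _ "\<lambda>i. if i = 0 then a else if i = 1 then x else b"])
            (auto simp: mono_on_def numeral_2_eq_2)
      qed
      then show ?case using \<open>\<delta> > 0\<close> by blast
    qed
    then show ?thesis using \<open>u \<le> v\<close> by (simp add: P_def)
  qed
  have refine: "inscribed m2 h (t 0) (t k) (\<Sum>i<k. mdist m1 (g (t i)) (g (t (Suc i))))"
    if "t \<in> {..k} \<rightarrow> I" "mono_on {..k} t" for k and t :: "nat \<Rightarrow> real"
    using that
  proof (induction k)
    case 0
    then show ?case
      unfolding inscribed_def by (intro exI[of _ 0] exI[of _ t]) auto
  next
    case (Suc k)
    have "inscribed m2 h (t 0) (t k) (\<Sum>i<k. mdist m1 (g (t i)) (g (t (Suc i))))"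
      using Suc.prems by (intro Suc.IH) (auto simp: mono_on_def Pi_iff)
    moreover have "inscribed m2 h (t k) (t (Suc k)) (mdist m1 (g (t k)) (g (t (Suc k))))"
      using Suc.prems by (intro chord) (auto simp: mono_on_def Pi_iff)
    ultimately show ?case by (simp add: inscribed_append)
  qed
  show ?thesis
    unfolding curve_length_def
  proof (rule SUP_least, clarify)
    fix k :: nat and t :: "nat \<Rightarrow> real"
    assume t: "t \<in> {..k} \<rightarrow> I" "mono_on {..k} t"
    from refine[OF t] obtain l and s :: "nat \<Rightarrow> real" where
      s: "s \<in> {..l} \<rightarrow> {t 0..t k}" "mono_on {..l} s"
      and le: "(\<Sum>i<k. mdist m1 (g (t i)) (g (t (Suc i))))
        \<le> (\<Sum>i<l. mdist m2 (h (s i)) (h (s (Suc i))))"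
      unfolding inscribed_def by blast
    have "x \<in> I" if "x \<in> {t 0..t k}" for x
      by (rule mem_is_interval_1_I[OF I, of "t 0" "t k"]) (use t that in auto)
    with s have sI: "s \<in> {..l} \<rightarrow> I" by blast
    have "(\<Sum>i<k. ennreal (mdist m1 (g (t i)) (g (t (Suc i)))))
        \<le> (\<Sum>i<l. ennreal (mdist m2 (h (s i)) (h (s (Suc i)))))"
      using le by (simp add: sum_ennreal ennreal_leI)
    also have "\<dots> \<le> (SUP (k, t) \<in> {(k::nat, t). t \<in> {..k} \<rightarrow> I \<and> mono_on {..k} t}.
        \<Sum>i<k. ennreal (mdist m2 (h (t i)) (h (t (Suc i)))))"
      by (rule SUP_upper2[of "(l, s)"]) (use s sI in auto)
    finally show "(\<Sum>i<k. ennreal (mdist m1 (g (t i)) (g (t (Suc i))))) \<le> \<dots>" .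
  qed
qed

lemma curve_length_locally_radial_isometry:
  assumes f: "f \<in> mspace m1 \<rightarrow> mspace m2"
    and radial: "\<And>x. x \<in> mspace m1 \<Longrightarrow>
      \<exists>r>0. \<forall>y\<in>mspace m1. mdist m1 x y < r \<longrightarrow> mdist m2 (f x) (f y) = mdist m1 x y"
    and I: "is_interval I" and \<gamma>: "continuous_map (top_of_set I) (mtopology_of m1) \<gamma>"
  shows "curve_length m2 I (f \<circ> \<gamma>) = curve_length m1 I \<gamma>"
proof -
  have in1: "\<gamma> t \<in> mspace m1" if "t \<in> I" for t
    using continuous_map_image_subset_topspace[OF \<gamma>] that by auto
  have loc: "\<exists>\<delta>>0. \<forall>t\<in>I. \<bar>t - x\<bar> < \<delta> \<longrightarrow>
      mdist m2 ((f \<circ> \<gamma>) t) ((f \<circ> \<gamma>) x) = mdist m1 (\<gamma> t) (\<gamma> x)" if x: "x \<in> I" for x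
  proof -
    from radial[OF in1[OF x]] obtain r where r: "r > 0"
      "\<And>y. y \<in> mspace m1 \<Longrightarrow> mdist m1 (\<gamma> x) y < r \<Longrightarrow> mdist m2 (f (\<gamma> x)) (f y) = mdist m1 (\<gamma> x) y"
      by blast
    have "continuous_map (top_of_set I) euclidean (\<lambda>t. mdist m1 (\<gamma> x) (\<gamma> t))"
      using \<gamma> in1[OF x] by (intro continuous_map_mdist) auto
    then have "continuous_on I (\<lambda>t. mdist m1 (\<gamma> x) (\<gamma> t))" by simp
    then obtain \<delta> where "\<delta> > 0" and
      \<delta>: "\<And>t. t \<in> I \<Longrightarrow> dist t x < \<delta> \<Longrightarrow> dist (mdist m1 (\<gamma> x) (\<gamma> t)) (mdist m1 (\<gamma> x) (\<gamma> x)) < r"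
      using x \<open>r > 0\<close> unfolding continuous_on_iff by metis
    have zero: "mdist m1 (\<gamma> x) (\<gamma> x) = 0" using in1[OF x] by simp
    have "mdist m2 (f (\<gamma> t)) (f (\<gamma> x)) = mdist m1 (\<gamma> t) (\<gamma> x)" if t: "t \<in> I" "\<bar>t - x\<bar> < \<delta>" for t
    proof -
      have "mdist m1 (\<gamma> x) (\<gamma> t) < r"
        using \<delta>[OF t(1)] t(2) zero unfolding dist_real_def by linarith
      then show ?thesis
        using r(2)[OF in1[OF t(1)]] by (simp add: mdist_commute)
    qed
    with \<open>\<delta> > 0\<close> show ?thesis by auto
  qed
  show ?thesis
  proof (rule antisym)
    show "curve_length m2 I (f \<circ> \<gamma>) \<le> curve_length m1 I \<gamma>"
      by (rule curve_length_le_if_locally_le[OF I]) (use f in1 loc in \<open>fastforce+\<close>)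
    show "curve_length m1 I \<gamma> \<le> curve_length m2 I (f \<circ> \<gamma>)"
      by (rule curve_length_le_if_locally_le[OF I]) (use in1 loc in \<open>fastforce+\<close>)
  qed
qed

section \<open>The structure theorem\<close>

lemma open_map_zero_sum_extension:
  "open_map (mtopology_of (unordered_tuples m)) (mtopology_of (centered_tuples (Suc m)))
     (zero_sum_extension :: 'a::real_inner multiset \<Rightarrow> _)"
  unfolding open_map_def
proof (intro allI impI)
  fix U :: "'a multiset set"
  interpret A: Metric_space "mspace (unordered_tuples m :: 'a multiset metric)" unordered_dist
    using Metric_space_mspace_mdist[of "unordered_tuples m"] by simp
  interpret Z: Metric_space "mspace (centered_tuples (Suc m) :: 'a multiset metric)" unordered_dist
    using Metric_space_mspace_mdist[of "centered_tuples (Suc m)"] by simp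
  assume "openin (mtopology_of (unordered_tuples m)) U"
  then have "openin A.mtopology U" by (simp only: mtopology_of_def mdist_unordered_tuples)
  then have sub: "\<And>X. X \<in> U \<Longrightarrow> size X = m"
    and ball: "\<And>X. X \<in> U \<Longrightarrow> \<exists>r>0. A.mball X r \<subseteq> U"
    unfolding A.openin_mtopology by auto
  have "\<exists>r>0. Z.mball (zero_sum_extension X) r \<subseteq> zero_sum_extension ` U" if XU: "X \<in> U" for X
  proof -
    obtain r where r: "r > 0" "A.mball X r \<subseteq> U" using ball[OF XU] by blast
    have "W \<in> zero_sum_extension ` U" if W: "W \<in> Z.mball (zero_sum_extension X) r" for W
    proof -
      from W have W: "size W = Suc (size X)" "barycenter W = 0"
        "unordered_dist (zero_sum_extension X) W < r"
        using sub[OF XU] unfolding Z.in_mball by auto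
      obtain Y where "size Y = size X" "zero_sum_extension Y = W"
        "unordered_dist X Y \<le> unordered_dist (zero_sum_extension X) W"
        using zero_sum_extension_lift[OF W(1,2)] by blast
      then have "Y \<in> A.mball X r" "zero_sum_extension Y = W"
        using W sub[OF XU] unfolding A.in_mball by auto
      then show ?thesis using r by blast
    qed
    with \<open>r > 0\<close> show ?thesis by blast
  qed
  moreover have "zero_sum_extension ` U \<subseteq> mspace (centered_tuples (Suc m))"
    using sub by (auto simp: barycenter_zero_sum_extension)
  ultimately show "openin (mtopology_of (centered_tuples (Suc m))) (zero_sum_extension ` U)"
    unfolding mtopology_of_def mdist_centered_tuples Z.openin_mtopology by blast
qed

theorem propositionA1:
  fixes d :: nat
  assumes "d \<ge> 1"
  shows "isometric_embedding
           (unordered_tuples d :: (real ^ 'n) multiset metric)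
           (prod_metric euclidean_metric (centered_tuples d))
           (split_barycenter d)
       \<and> homeomorphic_map
           (mtopology_of (unordered_tuples d :: (real ^ 'n) multiset metric))
           (mtopology_of (prod_metric euclidean_metric (centered_tuples d)))
           (split_barycenter d)
       \<and> (\<nexists>\<gamma>. isometric_embedding (euclidean_metric :: real metric)
                 (centered_tuples d :: (real ^ 'n) multiset metric) \<gamma>)
       \<and> (\<exists>F :: (real ^ 'n) multiset \<Rightarrow> (real ^ 'n) multiset.
             continuous_map (mtopology_of (unordered_tuples (d - 1))) (mtopology_of (centered_tuples d)) F
           \<and> open_map (mtopology_of (unordered_tuples (d - 1))) (mtopology_of (centered_tuples d)) F
           \<and> (\<forall>p \<in> mspace (centered_tuples d).
                 finite {X \<in> mspace (unordered_tuples (d - 1)). F X = p}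
               \<and> card {X \<in> mspace (unordered_tuples (d - 1)). F X = p} \<le> d)
           \<and> (\<forall>I \<gamma>. is_interval I
                  \<and> continuous_map (top_of_set I) (mtopology_of (unordered_tuples (d - 1))) \<gamma>
                \<longrightarrow> curve_length (centered_tuples d) I (F \<circ> \<gamma>)
                    = curve_length (unordered_tuples (d - 1)) I \<gamma>))"
proof (intro conjI)
  let ?A = "unordered_tuples d :: (real ^ 'n) multiset metric"
  let ?RZ = "prod_metric (euclidean_metric :: (real ^ 'n) metric) (centered_tuples d)"
  have onto: "split_barycenter d ` mspace ?A = mspace ?RZ"
    using split_barycenter_image[OF assms] by simp
  have iso: "mdist ?RZ (split_barycenter d X) (split_barycenter d Y) = mdist ?A X Y"
    if "X \<in> mspace ?A" "Y \<in> mspace ?A" for X Y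
    using mdist_split_barycenter[of X d Y] that assms by simp
  show "isometric_embedding ?A ?RZ (split_barycenter d)"
    unfolding isometric_embedding_def using onto iso by blast
  show "homeomorphic_map (mtopology_of ?A) (mtopology_of ?RZ) (split_barycenter d)"
    unfolding mtopology_of_def
    by (rule Metric_space12.isometry_imp_homeomorphic_map[OF Metric_space12_mspace_mdist onto iso])
next
  show "\<nexists>\<gamma>. isometric_embedding (euclidean_metric :: real metric)
      (centered_tuples d :: (real ^ 'n) multiset metric) \<gamma>"
    using no_line_in_centered_tuples by blast
next
  obtain m where d: "d = Suc m" using assms by (cases d) auto
  let ?A = "unordered_tuples m :: (real ^ 'n) multiset metric"
  let ?Z = "centered_tuples d :: (real ^ 'n) multiset metric"
  let ?F = "zero_sum_extension :: (real ^ 'n) multiset \<Rightarrow> _"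
  have maps: "?F \<in> mspace ?A \<rightarrow> mspace ?Z"
    by (auto simp: d barycenter_zero_sum_extension)
  have cont: "continuous_map (mtopology_of ?A) (mtopology_of ?Z) ?F"
    by (rule Lipschitz_continuous_imp_continuous_map, unfold Lipschitz_continuous_map_def)
      (use maps in \<open>auto intro!: exI[of _ 1] unordered_dist_zero_sum_extension_le\<close>)
  have fibre: "finite {X \<in> mspace ?A. ?F X = p} \<and> card {X \<in> mspace ?A. ?F X = p} \<le> d"
    if "p \<in> mspace ?Z" for p
    using zero_sum_extension_fibre[of p m] that d by simp
  have radial: "\<exists>r>0. \<forall>Y\<in>mspace ?A. mdist ?A X Y < r \<longrightarrow> mdist ?Z (?F X) (?F Y) = mdist ?A X Y"
    if "X \<in> mspace ?A" for X
    using that unordered_dist_zero_sum_extension_near[of X] by simp metis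
  show "\<exists>F :: (real ^ 'n) multiset \<Rightarrow> (real ^ 'n) multiset.
             continuous_map (mtopology_of (unordered_tuples (d - 1))) (mtopology_of (centered_tuples d)) F
           \<and> open_map (mtopology_of (unordered_tuples (d - 1))) (mtopology_of (centered_tuples d)) F
           \<and> (\<forall>p \<in> mspace (centered_tuples d).
                 finite {X \<in> mspace (unordered_tuples (d - 1)). F X = p}
               \<and> card {X \<in> mspace (unordered_tuples (d - 1)). F X = p} \<le> d)
           \<and> (\<forall>I \<gamma>. is_interval I
                  \<and> continuous_map (top_of_set I) (mtopology_of (unordered_tuples (d - 1))) \<gamma>
                \<longrightarrow> curve_length (centered_tuples d) I (F \<circ> \<gamma>)
                    = curve_length (unordered_tuples (d - 1)) I \<gamma>)"
  proof (intro exI[of _ ?F] conjI ballI allI impI)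
    have m: "d - 1 = m" by (simp add: d)
    show "continuous_map (mtopology_of (unordered_tuples (d - 1))) (mtopology_of ?Z) ?F"
      unfolding m by (rule cont)
    show "open_map (mtopology_of (unordered_tuples (d - 1))) (mtopology_of ?Z) ?F"
      unfolding m unfolding d by (rule open_map_zero_sum_extension)
    fix p assume "p \<in> mspace ?Z"
    then show "finite {X \<in> mspace (unordered_tuples (d - 1)). ?F X = p}"
      "card {X \<in> mspace (unordered_tuples (d - 1)). ?F X = p} \<le> d"
      unfolding m using fibre by blast+
  next
    fix I :: "real set" and \<gamma> :: "real \<Rightarrow> (real ^ 'n) multiset"
    assume "is_interval I \<and> continuous_map (top_of_set I) (mtopology_of (unordered_tuples (d - 1))) \<gamma>"
    then show "curve_length ?Z I (?F \<circ> \<gamma>) = curve_length (unordered_tuples (d - 1)) I \<gamma>"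
      unfolding diff_Suc_1 d
      using curve_length_locally_radial_isometry[OF maps radial] by (simp add: d)
  qed
qed

end
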